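(* For $m\ge 0$, we have $$D_{m,\lambda}^{(k)}(\lambda x) = m! \sum_{n=0}^m \ \sum_{i_1+i_2+\cdots+i_n=m} \frac{D_n^{(k)}(x)}{n!}\binom{\lambda}{i_1}\binom{\lambda}{i_2}\cdots\binom{\lambda}{i_n}.$$
   Context: Here $k\in\mathbb{N}$ is the order, $\lambda$ is a parameter, $x$ is the polynomial variable, and $\binom{\lambda}{i}$ denotes the binomial coefficient. The Daehee polynomials $D_n^{(k)}(x)$ of order $k$ are defined by the generating function $$\sum_{n=0}^\infty D_n^{(k)}(x)\frac{t^n}{n!} = \left(\frac{\log(1+t)}{t}\right)^k (1+t)^x .$$ The $\lambda$-Daehee polynomials $D_{n,\lambda}^{(k)}(x)$ of the first kind with order $k$ are defined by the generating function $$\left(\frac{\lambda\log(1+t)}{(1+t)^\lambda-1}\right)^k(1+t)^x = \sum_{n=0}^\infty D_{n,\lambda}^{(k)}(x)\frac{t^n}{n!}.$$ *)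

theory Defs
  imports "HOL-Computational_Algebra.Formal_Power_Series"
begin

text \<open>
  All generating functions are formal power series in \<open>t\<close> over an arbitrary field of
  characteristic 0. There \<open>fps_ln 1\<close> is \<open>log (1 + t)\<close> and \<open>fps_binomial c\<close> is \<open>(1 + t)\<close>
  to the power \<open>c\<close>, with coefficients \<open>c gchoose n\<close>.
  The value \<open>x\<close> ranges over the whole field, so the case of an indeterminate \<open>x\<close>
  is obtained by taking a field of rational functions.
\<close>

definition daehee_gf :: "nat \<Rightarrow> 'a::field_char_0 \<Rightarrow> 'a fps" where
  "daehee_gf k x = (fps_ln 1 / fps_X) ^ k * fps_binomial x"

definition daehee :: "nat \<Rightarrow> nat \<Rightarrow> 'a::field_char_0 \<Rightarrow> 'a" where
  "daehee k n x = fact n * fps_nth (daehee_gf k x) n"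

text \<open>
  For \<open>lam = 0\<close> the quotient below is 0/0, so the following two notions are
  meaningful only for \<open>lam \<noteq> 0\<close>.
\<close>

definition lambda_daehee_gf :: "'a::field_char_0 \<Rightarrow> nat \<Rightarrow> 'a \<Rightarrow> 'a fps" where
  "lambda_daehee_gf lam k x =
     (fps_const lam * fps_ln 1 / (fps_binomial lam - 1)) ^ k * fps_binomial x"

definition lambda_daehee :: "'a::field_char_0 \<Rightarrow> nat \<Rightarrow> nat \<Rightarrow> 'a \<Rightarrow> 'a" where
  "lambda_daehee lam k n x = fact n * fps_nth (lambda_daehee_gf lam k x) n"

text \<open>
  The index set \<open>i\<^sub>1 + \<dots> + i\<^sub>n = m\<close> consists of tuples of \<^emph>\<open>positive\<close> integers: it comes from
  the \<open>n\<close>-th power of \<open>fps_binomial lam - 1\<close>, which has no constant term.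
\<close>

definition compositions :: "nat \<Rightarrow> nat \<Rightarrow> nat list set" where
  "compositions n m = {is. length is = n \<and> (\<forall>i\<in>set is. 1 \<le> i) \<and> sum_list is = m}"

lemma finite_compositions: "finite (compositions n m)"
proof (rule finite_subset)
  show "compositions n m \<subseteq> {is. set is \<subseteq> {..m} \<and> length is = n}"
    by (auto simp: compositions_def member_le_sum_list)
  show "finite {is. set is \<subseteq> {..m} \<and> length is = n}"
    by (rule finite_lists_length_eq) simp
qed

lemma daehee_generating_function:
  "Abs_fps (\<lambda>n. daehee k n x / fact n) = (fps_ln 1 / fps_X) ^ k * fps_binomial x"
  by (simp add: fps_eq_iff daehee_def daehee_gf_def)

lemma lambda_daehee_generating_function:
  "Abs_fps (\<lambda>n. lambda_daehee lam k n x / fact n) =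
     (fps_const lam * fps_ln 1 / (fps_binomial lam - 1)) ^ k * fps_binomial x"
  by (simp add: fps_eq_iff lambda_daehee_def lambda_daehee_gf_def)

text \<open>
  Division of formal power series is truncating in general; the two quotients used above
  are exact.
\<close>

lemma fps_ln_div_fps_X_exact:
  "(fps_ln 1 / fps_X) * fps_X = (fps_ln 1 :: 'a::field_char_0 fps)"
  proof (rule dvd_div_mult_self)
  have "fps_nth (fps_ln 1 :: 'a fps) 1 \<noteq> 0"
    by (simp add: fps_ln_def)
  then have f: "(fps_ln 1 :: 'a fps) \<noteq> 0"
    by (metis fps_zero_nth)
  have "1 \<le> subdegree (fps_ln 1 :: 'a fps)"
    using f by (intro subdegree_geI) (auto simp: fps_ln_def)
  then show "fps_X dvd (fps_ln 1 :: 'a fps)"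
    using f by (subst fps_dvd_iff) auto
qed

lemma lambda_quotient_exact:
  fixes lam :: "'a::field_char_0"
  assumes "lam \<noteq> 0"
  shows "(fps_const lam * fps_ln 1 / (fps_binomial lam - 1)) * (fps_binomial lam - 1)
           = fps_const lam * fps_ln 1"
proof (rule dvd_div_mult_self)
  have nz: "fps_nth (fps_binomial lam - 1) 1 \<noteq> 0"
    using assms by simp
  then have g: "fps_binomial lam - 1 \<noteq> 0"
    by (metis fps_zero_nth)
  have sg: "subdegree (fps_binomial lam - 1) \<le> 1"
    using nz by (rule subdegree_leI)
  have l: "fps_nth (fps_const lam * fps_ln 1) 1 \<noteq> 0"
    using assms by (simp add: fps_ln_def)
  then have f: "fps_const lam * fps_ln 1 \<noteq> 0"
    by (metis fps_zero_nth)
  have sf: "1 \<le> subdegree (fps_const lam * fps_ln 1)"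
    using f by (intro subdegree_geI) (auto simp: fps_ln_def)
  show "fps_binomial lam - 1 dvd fps_const lam * fps_ln 1"
    using fps_dvd_iff[OF g f] sf sg by linarith
qed

end

theory Submission
  imports Defs
begin

unbundle fps_syntax

text \<open>
  Substituting \<open>(1 + t)\<^sup>\<lambda> - 1\<close> for \<open>t\<close> turns \<open>log (1 + t)\<close> into \<open>\<lambda> log (1 + t)\<close> and
  \<open>(1 + t)\<^sup>x\<close> into \<open>(1 + t)\<close> to the power \<open>\<lambda>x\<close>, so it carries the generating function of the
  Daehee polynomials at \<open>x\<close> to that of the \<open>\<lambda>\<close>-Daehee polynomials at \<open>\<lambda>x\<close>. The formula is
  the comparison of coefficients, with the powers of \<open>(1 + t)\<^sup>\<lambda> - 1\<close> expanded over compositions.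
\<close>

text \<open>Expanding the power gives a sum over all tuples of naturals,
  \<open>natpermute m n\<close>; a tuple with a zero entry contributes the factor
  \<open>a $ 0 = 0\<close>, so only positive tuples survive.\<close>

lemma fps_power_nth_compositions:
  fixes a :: "'a::comm_ring_1 fps"
  assumes "a $ 0 = 0"
  shows "(a ^ n) $ m = (\<Sum>is\<in>compositions n m. \<Prod>i\<leftarrow>is. a $ i)"
proof -
  have "(a ^ n) $ m = (\<Sum>is\<in>natpermute m n. \<Prod>i\<leftarrow>is. a $ i)"
  proof (cases n)
    case 0
    then have "natpermute m n = (if m = 0 then {[]} else {})"
      by (auto simp: natpermute_def)
    with 0 show ?thesis by simp
  next
    case (Suc k)
    have "(\<Prod>j=0..k. a $ (v ! j)) = (\<Prod>i\<leftarrow>v. a $ i)" if "length v = Suc k" for v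
      using that by (simp add: prod.list_conv_set_nth atLeastLessThanSuc_atLeastAtMost)
    then show ?thesis
      unfolding Suc fps_power_nth_Suc by (intro sum.cong) (auto simp: natpermute_def)
  qed
  also have "\<dots> = (\<Sum>is\<in>compositions n m. \<Prod>i\<leftarrow>is. a $ i)"
  proof (rule sum.mono_neutral_right)
    show "finite (natpermute m n)" by (rule natpermute_finite)
    show "compositions n m \<subseteq> natpermute m n"
      by (auto simp: compositions_def natpermute_def)
    show "\<forall>is\<in>natpermute m n - compositions n m. (\<Prod>i\<leftarrow>is. a $ i) = 0"
    proof
      fix js assume "js \<in> natpermute m n - compositions n m"
      then have "0 \<in> set js"
        by (auto simp: compositions_def natpermute_def Suc_le_eq)
      with assms have "0 \<in> set (map (fps_nth a) js)" by force
      then show "(\<Prod>i\<leftarrow>js. a $ i) = 0" by (induction js) auto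
    qed
  qed
  finally show ?thesis .
qed

lemma inverse_one_plus_fps_X_compose_binomial:
  fixes c :: "'a::field_char_0"
  shows "inverse (1 + fps_X) oo (fps_binomial c - 1) = inverse (fps_binomial c)"
  by (simp add: fps_inverse_compose fps_compose_add_distrib)

text \<open>Both sides have derivative \<open>c / (1 + t)\<close> and constant term 0.\<close>

lemma fps_ln_compose_binomial:
  fixes c :: "'a::field_char_0"
  shows "fps_ln 1 oo (fps_binomial c - 1) = fps_const c * fps_ln 1"
proof -
  let ?B = "fps_binomial c"
  have "fps_deriv (fps_ln 1 oo (?B - 1)) = inverse ?B * (fps_const c * ?B / (1 + fps_X))"
    by (simp add: fps_compose_deriv fps_ln_deriv fps_binomial_deriv
        inverse_one_plus_fps_X_compose_binomial)
  also have "\<dots> = (inverse ?B * ?B) * (fps_const c * inverse (1 + fps_X))"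
    by (simp add: fps_divide_unit mult_ac)
  also have "\<dots> = fps_deriv (fps_const c * fps_ln 1)"
    by (simp add: inverse_mult_eq_1 fps_ln_deriv)
  finally show ?thesis
    by (subst (asm) fps_deriv_eq_iff) simp
qed

text \<open>The composite solves \<open>(1 + t) y' = c x y\<close> with \<open>y(0) = 1\<close>,
  which determines \<open>fps_binomial (c * x)\<close>.\<close>

lemma fps_binomial_compose_binomial:
  fixes c x :: "'a::field_char_0"
  shows "fps_binomial x oo (fps_binomial c - 1) = fps_binomial (c * x)"
proof -
  let ?B = "fps_binomial c" and ?C = "fps_binomial x oo (fps_binomial c - 1)"
  have "fps_deriv ?C =
      ((fps_const x * fps_binomial x * inverse (1 + fps_X)) oo (?B - 1)) *
      (fps_const c * ?B * inverse (1 + fps_X))"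
    by (simp add: fps_compose_deriv fps_binomial_deriv fps_divide_unit)
  also have "\<dots> = (fps_const c * fps_const x) * ?C * (inverse ?B * ?B) * inverse (1 + fps_X)"
    by (simp only: fps_compose_mult_distrib inverse_one_plus_fps_X_compose_binomial
        fps_const_compose mult_ac)
       (simp add: fps_compose_mult_distrib inverse_one_plus_fps_X_compose_binomial mult_ac)
  also have "\<dots> = fps_const (c * x) * ?C / (1 + fps_X)"
    by (simp add: inverse_mult_eq_1 fps_divide_unit)
  finally show ?thesis
    by (subst fps_binomial_ODE_unique' [symmetric]) simp
qed

lemma daehee_gf_compose_binomial:
  fixes lam x :: "'a::field_char_0"
  assumes "lam \<noteq> 0"
  shows "daehee_gf k x oo (fps_binomial lam - 1) = lambda_daehee_gf lam k (lam * x)"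
proof -
  let ?G = "fps_binomial lam - 1"
  have "?G $ 1 \<noteq> 0" using assms by simp
  then have G: "?G \<noteq> 0" by (metis fps_zero_nth)
  \<comment> \<open>To avoid composing a truncating quotient, both sides are multiplied by
    \<open>?G\<close>, where exactness applies; the nonzero \<open>?G\<close> is then
    cancelled.\<close>
  have "((fps_ln 1 / fps_X) oo ?G) * ?G = ((fps_ln 1 / fps_X) * fps_X) oo ?G"
    by (simp add: fps_compose_mult_distrib)
  also have "\<dots> = (fps_const lam * fps_ln 1 / ?G) * ?G"
    by (simp only: fps_ln_div_fps_X_exact fps_ln_compose_binomial lambda_quotient_exact [OF assms])
  finally have "(fps_ln 1 / fps_X) oo ?G = fps_const lam * fps_ln 1 / ?G"
    using G by simp
  then show ?thesis
    by (simp add: daehee_gf_def lambda_daehee_gf_def fps_compose_mult_distrib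
        fps_compose_power [symmetric] fps_binomial_compose_binomial)
qed

theorem theorem3p2:
  fixes lam x :: "'a::field_char_0" and k m :: nat
  assumes "lam \<noteq> 0"
  shows "lambda_daehee lam k m (lam * x) =
    fact m * (\<Sum>n=0..m. \<Sum>is\<in>compositions n m.
      daehee k n x / fact n * (\<Prod>i\<leftarrow>is. lam gchoose i))"
proof -
  let ?G = "fps_binomial lam - 1"
  have "(?G ^ n) $ m = (\<Sum>is\<in>compositions n m. \<Prod>i\<leftarrow>is. lam gchoose i)" for n
  proof -
    have "(?G ^ n) $ m = (\<Sum>is\<in>compositions n m. \<Prod>i\<leftarrow>is. ?G $ i)"
      by (rule fps_power_nth_compositions) simp
    also have "\<dots> = (\<Sum>is\<in>compositions n m. \<Prod>i\<leftarrow>is. lam gchoose i)"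
      \<comment> \<open>Positivity of the entries matters: \<open>?G $ 0\<close> is 0, while
        \<open>lam gchoose 0\<close> is 1.\<close>
      by (intro sum.cong refl arg_cong [where f = prod_list] map_cong)
         (auto simp: compositions_def)
    finally show ?thesis .
  qed
  then show ?thesis
    by (simp add: lambda_daehee_def daehee_gf_compose_binomial [OF assms, symmetric]
        fps_compose_nth daehee_def sum_distrib_left)
qed

end
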